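(* Suppose that the epigraph of $f$ over $\Omega$, $\{(\mathbf{w},s)\in\Omega\times\mathbb{R}: f(\mathbf{w})\le s\}$, is a polyhedron, and let $\kappa>0$ be a polyhedral error bound constant, i.e. $\|\mathbf{w}-\mathbf{w}^*\|_2\le\frac{f(\mathbf{w})-f_*}{\kappa}$ for all $\mathbf{w}\in\Omega$. Fix $\mathbf{w}_0\in\Omega$, $\alpha>1$, and $\epsilon_0>0$ with $f(\mathbf{w}_0)-f_*\le\epsilon_0$. Then the iteration complexity of RSG for obtaining an $\epsilon$-optimal solution is $O\left(\frac{\alpha^2G^2}{\kappa^2}\lceil\log_\alpha(\frac{\epsilon_0}{\epsilon})\rceil\right)$. Precisely: there is a constant $C>0$ independent of $\epsilon$ such that for every $\epsilon\in(0,\epsilon_0]$, running RSG$(\mathbf{w}_0,K,t,\alpha)$ with $t=\left\lceil\frac{\alpha^2G^2}{\kappa^2}\right\rceil$ and $K=\lceil\log_\alpha(\epsilon_0/\epsilon)\rceil$ returns $\mathbf{w}_K$ with $f(\mathbf{w}_K)-f_*\le\epsilon$ after a total number of iterations at most $C\,\frac{\alpha^2G^2}{\kappa^2}\lceil\log_\alpha(\frac{\epsilon_0}{\epsilon})\rceil$.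
   Context: Problem: $f:\mathbb{R}^d\to(-\infty,+\infty]$ is lower semicontinuous and convex, $\Omega\subseteq\mathrm{dom}(f)$ is a closed convex subset of $\mathbb{R}^d$, $f_*:=\min_{\mathbf{w}\in\Omega}f(\mathbf{w})$ is attained, and $\Omega_*\subseteq\Omega$ is the (nonempty) set of minimizers of $f$ over $\Omega$. Bounded subgradients: there is a constant $G>0$ such that for every $\mathbf{w}\in\Omega$ the subdifferential $\partial f(\mathbf{w})$ is nonempty and $\|\mathbf{v}\|_2\le G$ for all $\mathbf{v}\in\partial f(\mathbf{w})$. For $\mathbf{w}\in\Omega$, $\mathbf{w}^*$ denotes the point of $\Omega_*$ closest to $\mathbf{w}$ in Euclidean norm. (A constant $\kappa$ as in the claim is known to exist whenever the epigraph of $f$ over $\Omega$ is a polyhedron, possibly unbounded.) Algorithm RSG$(\mathbf{w}_0,K,t,\alpha)$ (given $\epsilon_0$ and $G$): for $k=1,\dots,K$ let $\eta_k=\epsilon_0/(\alpha^kG^2)$; set $\mathbf{x}_1=\mathbf{w}_{k-1}$ and, for $\tau=1,\dots,t$, $\mathbf{x}_{\tau+1}=\Pi_\Omega[\mathbf{x}_\tau-\eta_k\mathbf{g}_\tau]$, where $\mathbf{g}_\tau\in\partial f(\mathbf{x}_\tau)$ is an arbitrary subgradient returned by an oracle and $\Pi_\Omega$ is the Euclidean projection onto $\Omega$; set $\mathbf{w}_k=\frac1t\sum_{\tau=1}^t\mathbf{x}_\tau$. Output $\mathbf{w}_K$. Each $k$ is a stage; each $\tau$ within a stage is one iteration, so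 the total number of iterations is $tK$. *)

theory Defs
  imports "HOL-Analysis.Analysis"
begin

text \<open>
  A function \<open>f : E \<rightarrow> (-\<infinity>, +\<infinity>]\<close> is represented as an \<^typ>\<open>ereal\<close>-valued function
  that never takes the value \<open>-\<infinity>\<close>.  The definitions below are meant for such functions.
\<close>

definition effective_domain :: "('a \<Rightarrow> ereal) \<Rightarrow> 'a set" where
  "effective_domain f = {x. f x < \<infinity>}"

definition lower_semicontinuous :: "('a::topological_space \<Rightarrow> ereal) \<Rightarrow> bool" where
  "lower_semicontinuous f \<longleftrightarrow> (\<forall>x. f x \<le> Liminf (at x) f)"

text \<open>
  The right-hand side uses \<open>0 * \<infinity> = 0\<close>, as is usual in convex analysis, and it is free of
  \<open>\<infinity> - \<infinity>\<close> because \<open>-\<infinity>\<close> is not a value of \<open>f\<close>.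
\<close>
definition ereal_convex :: "('a::real_vector \<Rightarrow> ereal) \<Rightarrow> bool" where
  "ereal_convex f \<longleftrightarrow>
     (\<forall>x y. \<forall>u\<ge>0. \<forall>v\<ge>0. u + v = 1 \<longrightarrow>
        f (u *\<^sub>R x + v *\<^sub>R y) \<le> ereal u * f x + ereal v * f y)"

text \<open>If \<open>f\<close> is proper, this set is empty at every \<open>w\<close> outside the effective domain.\<close>
definition subdifferential :: "('a::real_inner \<Rightarrow> ereal) \<Rightarrow> 'a \<Rightarrow> 'a set" where
  "subdifferential f w = {v. \<forall>u. f w + ereal (v \<bullet> (u - w)) \<le> f u}"

definition minimizers :: "('a \<Rightarrow> ereal) \<Rightarrow> 'a set \<Rightarrow> 'a set" where
  "minimizers f \<Omega> = {w \<in> \<Omega>. \<forall>u\<in>\<Omega>. f w \<le> f u}"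

text \<open>This is a minimum whenever \<open>minimizers f \<Omega>\<close> is nonempty.\<close>
definition min_value :: "('a \<Rightarrow> ereal) \<Rightarrow> 'a set \<Rightarrow> ereal" where
  "min_value f \<Omega> = (INF w\<in>\<Omega>. f w)"

definition epigraph_over :: "('a \<Rightarrow> ereal) \<Rightarrow> 'a set \<Rightarrow> ('a \<times> real) set" where
  "epigraph_over f \<Omega> = {(w, s). w \<in> \<Omega> \<and> f w \<le> ereal s}"

text \<open>
  The oracle answers a query point \<open>x\<close> in iteration \<open>\<tau>\<close> of stage \<open>k\<close> by \<open>g k \<tau> x\<close>.  The
  answer may depend on \<open>k\<close> and \<open>\<tau>\<close>, so different subgradients may be returned when the same
  point is queried repeatedly; every run of the method with arbitrarily chosen subgradients
  arises from such an oracle.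
\<close>
definition subgradient_oracle ::
    "('a::real_inner \<Rightarrow> ereal) \<Rightarrow> 'a set \<Rightarrow> (nat \<Rightarrow> nat \<Rightarrow> 'a \<Rightarrow> 'a) \<Rightarrow> bool" where
  "subgradient_oracle f \<Omega> g \<longleftrightarrow> (\<forall>k \<tau>. \<forall>x\<in>\<Omega>. g k \<tau> x \<in> subdifferential f x)"

text \<open>
  \<open>sg_iterate \<Omega> \<eta> g x n\<close> is the iterate \<open>x\<^sub>n\<^sub>+\<^sub>1\<close> of the projected subgradient method
  started at \<open>x\<^sub>1 = x\<close>.
\<close>
primrec sg_iterate ::
    "'a::euclidean_space set \<Rightarrow> real \<Rightarrow> (nat \<Rightarrow> 'a \<Rightarrow> 'a) \<Rightarrow> 'a \<Rightarrow> nat \<Rightarrow> 'a" where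
  "sg_iterate \<Omega> \<eta> g x 0 = x"
| "sg_iterate \<Omega> \<eta> g x (Suc n) =
     closest_point \<Omega> (sg_iterate \<Omega> \<eta> g x n - \<eta> *\<^sub>R g (Suc n) (sg_iterate \<Omega> \<eta> g x n))"

definition sg_average ::
    "'a::euclidean_space set \<Rightarrow> real \<Rightarrow> (nat \<Rightarrow> 'a \<Rightarrow> 'a) \<Rightarrow> 'a \<Rightarrow> nat \<Rightarrow> 'a" where
  "sg_average \<Omega> \<eta> g x t = (1 / real t) *\<^sub>R (\<Sum>\<tau>=1..t. sg_iterate \<Omega> \<eta> g x (\<tau> - 1))"

primrec rsg ::
    "'a::euclidean_space set \<Rightarrow> real \<Rightarrow> real \<Rightarrow> (nat \<Rightarrow> nat \<Rightarrow> 'a \<Rightarrow> 'a) \<Rightarrow>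
     'a \<Rightarrow> nat \<Rightarrow> nat \<Rightarrow> real \<Rightarrow> 'a" where
  "rsg \<Omega> G \<epsilon>0 g w0 0 t \<alpha> = w0"
| "rsg \<Omega> G \<epsilon>0 g w0 (Suc k) t \<alpha> =
     sg_average \<Omega> (\<epsilon>0 / (\<alpha> ^ Suc k * G\<^sup>2)) (g (Suc k)) (rsg \<Omega> G \<epsilon>0 g w0 k t \<alpha>) t"

text \<open>Each of the \<open>K\<close> stages consists of \<open>t\<close> iterations.\<close>
definition rsg_iterations :: "nat \<Rightarrow> nat \<Rightarrow> nat" where
  "rsg_iterations K t = t * K"

end

theory Submission
  imports Defs
begin

text \<open>
  Write \<open>D\<close> for a bound on the gap \<open>f w - f\<^sub>*\<close> and \<open>w\<^sup>*\<close> for the minimizer closest to \<open>w\<close>.  The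
  standard analysis of the projected subgradient method bounds the gap of the average of \<open>t\<close>
  iterates, relative to any comparison point \<open>u\<close> of \<open>\<Omega>\<close>, by
  \<open>\<parallel>x\<^sub>1 - u\<parallel>\<^sup>2 / (2 \<eta> t) + \<eta> G\<^sup>2 / 2\<close> (lemma \<open>subgradient_average_gap\<close>).  If the gap is at most
  \<open>D\<close> at the starting point \<open>x\<^sub>1\<close> of a stage, the error bound puts \<open>x\<^sub>1\<close> within \<open>D / \<kappa>\<close> of
  \<open>u = x\<^sub>1\<^sup>*\<close>.  With the step size \<open>\<eta> = D / (\<alpha> G\<^sup>2)\<close> and \<open>t \<ge> \<alpha>\<^sup>2 G\<^sup>2 / \<kappa>\<^sup>2\<close> each of the two terms is
  at most \<open>D / (2 \<alpha>)\<close>, so a stage divides the guaranteed gap by \<open>\<alpha>\<close> (lemma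
  \<open>stage_contraction\<close>), and \<open>K\<close> stages reach \<open>\<epsilon>0 / \<alpha> ^ K \<le> \<epsilon>\<close>.

  The error bound speaks about the closest minimizer, which is guaranteed to be a minimizer
  once the set of minimizers is known to be closed.  This holds because a subgradient exists at
  every point of \<open>\<Omega>\<close> (lemma \<open>closed_minimizers\<close>).  Since \<open>f\<close> is finite on \<open>\<Omega>\<close>, the
  quantitative argument is carried out for a real-valued function on \<open>\<Omega>\<close>.
\<close>

text \<open>
  Projecting onto a convex set cannot increase the distance to a point of that set; the right-hand
  side is the expanded square of the distance before the projection.
\<close>
lemma projected_step_distance:
  fixes \<Omega> :: "'a::euclidean_space set"
  assumes "closed \<Omega>" "convex \<Omega>" "u \<in> \<Omega>"
  shows "(norm (closest_point \<Omega> (x - \<eta> *\<^sub>R v) - u))\<^sup>2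
           \<le> (norm (x - u))\<^sup>2 - 2 * \<eta> * (v \<bullet> (x - u)) + \<eta>\<^sup>2 * (norm v)\<^sup>2"
proof -
  have "dist (closest_point \<Omega> (x - \<eta> *\<^sub>R v)) (closest_point \<Omega> u) \<le> dist (x - \<eta> *\<^sub>R v) u"
    using assms by (intro closest_point_lipschitz) auto
  then have "norm (closest_point \<Omega> (x - \<eta> *\<^sub>R v) - u) \<le> norm ((x - u) - \<eta> *\<^sub>R v)"
    using assms(3) by (simp add: closest_point_self dist_norm algebra_simps)
  then have "(norm (closest_point \<Omega> (x - \<eta> *\<^sub>R v) - u))\<^sup>2 \<le> (norm ((x - u) - \<eta> *\<^sub>R v))\<^sup>2"
    by (simp add: power_mono)
  also have "\<dots> = (norm (x - u))\<^sup>2 - 2 * \<eta> * (v \<bullet> (x - u)) + \<eta>\<^sup>2 * (norm v)\<^sup>2"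
    unfolding power2_norm_eq_inner
    by (simp add: inner_diff_left inner_diff_right inner_commute power2_eq_square algebra_simps)
  finally show ?thesis .
qed

lemma sg_iterate_in:
  assumes "closed \<Omega>" "x \<in> \<Omega>"
  shows "sg_iterate \<Omega> \<eta> g x n \<in> \<Omega>"
  using assms by (cases n) (auto intro!: closest_point_in_set)

lemma sg_average_eq:
  "sg_average \<Omega> \<eta> g x t = (\<Sum>n<t. (1 / real t) *\<^sub>R sg_iterate \<Omega> \<eta> g x n)"
proof -
  have "(\<Sum>\<tau>=1..t. sg_iterate \<Omega> \<eta> g x (\<tau> - 1)) = (\<Sum>n<t. sg_iterate \<Omega> \<eta> g x n)"
    by (rule sum.reindex_bij_witness[of _ Suc "\<lambda>n. n - 1"]) auto
  then show ?thesis
    by (simp add: sg_average_def scaleR_sum_right)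
qed

lemma sg_average_in:
  assumes "closed \<Omega>" "convex \<Omega>" "x \<in> \<Omega>" "t > 0"
  shows "sg_average \<Omega> \<eta> g x t \<in> \<Omega>"
  unfolding sg_average_eq using assms
  by (intro convex_sum) (auto intro: sg_iterate_in)

text \<open>
  By the subgradient inequality an iterate whose value exceeds that of \<open>u\<close> moves towards \<open>u\<close>, up
  to the error \<open>\<eta>\<^sup>2 G\<^sup>2\<close>.  The squared distances telescope; the last one is kept on the left-hand side
  to make the induction work.
\<close>
lemma subgradient_regret:
  fixes \<Omega> :: "'a::euclidean_space set" and F :: "'a \<Rightarrow> real"
  assumes \<Omega>: "closed \<Omega>" "convex \<Omega>" "x \<in> \<Omega>" "u \<in> \<Omega>" and "\<eta> \<ge> 0"
    and sub: "\<And>n y. y \<in> \<Omega> \<Longrightarrow> F y + g n y \<bullet> (u - y) \<le> F u"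
    and bnd: "\<And>n y. y \<in> \<Omega> \<Longrightarrow> norm (g n y) \<le> G"
  shows "(norm (sg_iterate \<Omega> \<eta> g x t - u))\<^sup>2 + 2 * \<eta> * (\<Sum>n<t. F (sg_iterate \<Omega> \<eta> g x n) - F u)
           \<le> (norm (x - u))\<^sup>2 + real t * (\<eta>\<^sup>2 * G\<^sup>2)"
proof (induction t)
  case 0
  then show ?case by simp
next
  case (Suc t)
  let ?y = "sg_iterate \<Omega> \<eta> g x t" and ?v = "g (Suc t) (sg_iterate \<Omega> \<eta> g x t)"
  have y: "?y \<in> \<Omega>" using \<Omega> by (simp add: sg_iterate_in)
  have "F ?y - F u \<le> ?v \<bullet> (?y - u)"
    using sub[OF y, of "Suc t"] by (simp add: inner_diff_right)
  then have "2 * \<eta> * (F ?y - F u) \<le> 2 * \<eta> * (?v \<bullet> (?y - u))"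
    using \<open>\<eta> \<ge> 0\<close> by (intro mult_left_mono) auto
  moreover have "\<eta>\<^sup>2 * (norm ?v)\<^sup>2 \<le> \<eta>\<^sup>2 * G\<^sup>2"
    using bnd[OF y] by (intro mult_left_mono power_mono) auto
  ultimately have "(norm (sg_iterate \<Omega> \<eta> g x (Suc t) - u))\<^sup>2
      \<le> (norm (?y - u))\<^sup>2 - 2 * \<eta> * (F ?y - F u) + \<eta>\<^sup>2 * G\<^sup>2"
    using projected_step_distance[OF \<Omega>(1,2,4), of ?y \<eta> ?v] by simp
  with Suc.IH show ?case by (simp add: algebra_simps)
qed

lemma subgradient_average_gap:
  fixes \<Omega> :: "'a::euclidean_space set" and F :: "'a \<Rightarrow> real"
  assumes \<Omega>: "closed \<Omega>" "x \<in> \<Omega>" "u \<in> \<Omega>" and F: "convex_on \<Omega> F"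
    and "\<eta> > 0" "t > 0"
    and sub: "\<And>n y. y \<in> \<Omega> \<Longrightarrow> F y + g n y \<bullet> (u - y) \<le> F u"
    and bnd: "\<And>n y. y \<in> \<Omega> \<Longrightarrow> norm (g n y) \<le> G"
  shows "F (sg_average \<Omega> \<eta> g x t) - F u \<le> (norm (x - u))\<^sup>2 / (2 * \<eta> * real t) + \<eta> * G\<^sup>2 / 2"
proof -
  let ?S = "\<Sum>n<t. F (sg_iterate \<Omega> \<eta> g x n) - F u"
  have "convex \<Omega>" using F by (rule convex_on_imp_convex)
  have "F (sg_average \<Omega> \<eta> g x t) \<le> (\<Sum>n<t. (1 / real t) * F (sg_iterate \<Omega> \<eta> g x n))"
    unfolding sg_average_eq using \<Omega> \<open>t > 0\<close>
    by (intro convex_on_sum[OF _ _ F]) (auto intro: sg_iterate_in)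
  then have avg: "F (sg_average \<Omega> \<eta> g x t) - F u \<le> ?S / real t"
    using \<open>t > 0\<close> by (simp add: sum_subtractf sum_divide_distrib[symmetric] diff_divide_distrib)
  have "2 * \<eta> * ?S \<le> (norm (x - u))\<^sup>2 + real t * (\<eta>\<^sup>2 * G\<^sup>2)"
    using subgradient_regret[where F=F and g=g and G=G and t=t and \<eta>=\<eta>,
        OF \<Omega>(1) \<open>convex \<Omega>\<close> \<Omega>(2,3) _ sub bnd] \<open>\<eta> > 0\<close>
    by (smt (verit) zero_le_power2)
  then have "?S / real t \<le> ((norm (x - u))\<^sup>2 + real t * (\<eta>\<^sup>2 * G\<^sup>2)) / (2 * \<eta> * real t)"
    using \<open>\<eta> > 0\<close> \<open>t > 0\<close> by (simp add: field_simps)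
  also have "\<dots> = (norm (x - u))\<^sup>2 / (2 * \<eta> * real t) + \<eta> * G\<^sup>2 / 2"
    using \<open>\<eta> > 0\<close> \<open>t > 0\<close> by (simp add: field_simps power2_eq_square)
  finally show ?thesis using avg by simp
qed

text \<open>
  The step size balances the two terms of the preceding bound: both become at most
  \<open>D / (2 \<alpha>)\<close> once the initial distance is at most \<open>D / \<kappa>\<close>.
\<close>
lemma stage_contraction:
  fixes \<Omega> :: "'a::euclidean_space set" and F :: "'a \<Rightarrow> real"
  assumes \<Omega>: "closed \<Omega>" "x \<in> \<Omega>" "u \<in> \<Omega>" and F: "convex_on \<Omega> F"
    and pos: "G > 0" "\<kappa> > 0" "\<alpha> > 0" "D > 0"
    and t: "\<alpha>\<^sup>2 * G\<^sup>2 / \<kappa>\<^sup>2 \<le> real t"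
    and sub: "\<And>n y. y \<in> \<Omega> \<Longrightarrow> F y + g n y \<bullet> (u - y) \<le> F u"
    and bnd: "\<And>n y. y \<in> \<Omega> \<Longrightarrow> norm (g n y) \<le> G"
    and dist: "norm (x - u) \<le> D / \<kappa>"
  shows "F (sg_average \<Omega> (D / (\<alpha> * G\<^sup>2)) g x t) - F u \<le> D / \<alpha>"
proof -
  let ?\<eta> = "D / (\<alpha> * G\<^sup>2)"
  have "0 < \<alpha>\<^sup>2 * G\<^sup>2 / \<kappa>\<^sup>2" using pos by simp
  with t have "t > 0" by (cases t) auto
  have \<eta>: "?\<eta> > 0" using pos by simp
  have "(norm (x - u))\<^sup>2 / (2 * ?\<eta> * real t) \<le> (D / \<kappa>)\<^sup>2 / (2 * ?\<eta> * (\<alpha>\<^sup>2 * G\<^sup>2 / \<kappa>\<^sup>2))"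
    using t pos \<eta> dist by (intro frac_le mult_left_mono power_mono) auto
  also have "\<dots> = D / (2 * \<alpha>)"
    using pos by (simp add: field_simps power2_eq_square)
  finally have "(norm (x - u))\<^sup>2 / (2 * ?\<eta> * real t) \<le> D / (2 * \<alpha>)" .
  moreover have "?\<eta> * G\<^sup>2 / 2 = D / (2 * \<alpha>)"
    using pos by simp
  ultimately show ?thesis
    using subgradient_average_gap[where g=g and G=G, OF \<Omega> F \<eta> \<open>t > 0\<close> sub bnd] by simp
qed

text \<open>
  Here \<open>p\<close> stands for the projection onto the set of minimizers.  Each stage is compared with the
  minimizer \<open>p x\<close> closest to its own starting point \<open>x\<close>, and the gap bound of one stage is,
  through the error bound, the distance bound of the next.
\<close>
lemma rsg_gap:
  fixes \<Omega> :: "'a::euclidean_space set" and F :: "'a \<Rightarrow> real"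
  assumes \<Omega>: "closed \<Omega>" and F: "convex_on \<Omega> F"
    and pos: "G > 0" "\<kappa> > 0" "\<alpha> > 0" "\<epsilon>0 > 0"
    and t: "\<alpha>\<^sup>2 * G\<^sup>2 / \<kappa>\<^sup>2 \<le> real t"
    and sub: "\<And>k n y u. y \<in> \<Omega> \<Longrightarrow> u \<in> \<Omega> \<Longrightarrow> F y + g k n y \<bullet> (u - y) \<le> F u"
    and bnd: "\<And>k n y. y \<in> \<Omega> \<Longrightarrow> norm (g k n y) \<le> G"
    and p: "\<And>x. x \<in> \<Omega> \<Longrightarrow> p x \<in> \<Omega>" "\<And>x. x \<in> \<Omega> \<Longrightarrow> F (p x) = m"
    and error_bound: "\<And>x. x \<in> \<Omega> \<Longrightarrow> norm (x - p x) \<le> (F x - m) / \<kappa>"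
    and w0: "w0 \<in> \<Omega>" "F w0 - m \<le> \<epsilon>0"
  shows "rsg \<Omega> G \<epsilon>0 g w0 K t \<alpha> \<in> \<Omega> \<and> F (rsg \<Omega> G \<epsilon>0 g w0 K t \<alpha>) - m \<le> \<epsilon>0 / \<alpha> ^ K"
proof (induction K)
  case 0
  then show ?case using w0 by simp
next
  case (Suc K)
  let ?x = "rsg \<Omega> G \<epsilon>0 g w0 K t \<alpha>" and ?D = "\<epsilon>0 / \<alpha> ^ K"
  have "0 < \<alpha>\<^sup>2 * G\<^sup>2 / \<kappa>\<^sup>2" using pos by simp
  with t have "t > 0" by (cases t) auto
  from Suc have x: "?x \<in> \<Omega>" and gap: "F ?x - m \<le> ?D" by auto
  have "norm (?x - p ?x) \<le> (F ?x - m) / \<kappa>" by (rule error_bound[OF x])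
  also have "\<dots> \<le> ?D / \<kappa>" using gap pos by (intro divide_right_mono) auto
  finally have near: "norm (?x - p ?x) \<le> ?D / \<kappa>" .
  have "F (sg_average \<Omega> (?D / (\<alpha> * G\<^sup>2)) (g (Suc K)) ?x t) - F (p ?x) \<le> ?D / \<alpha>"
    using pos sub bnd p(1)[OF x]
    by (intro stage_contraction[OF \<Omega> x p(1)[OF x] F pos(1-3) _ t _ _ near]) auto
  moreover have "?D / (\<alpha> * G\<^sup>2) = \<epsilon>0 / (\<alpha> ^ Suc K * G\<^sup>2)" "?D / \<alpha> = \<epsilon>0 / \<alpha> ^ Suc K"
    by (simp_all add: ac_simps)
  ultimately show ?case
    using p(2)[OF x] sg_average_in[OF \<Omega> convex_on_imp_convex[OF F] x \<open>t > 0\<close>]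
    by (simp add: ac_simps)
qed

lemma min_value_eq:
  assumes "w \<in> minimizers f \<Omega>"
  shows "min_value f \<Omega> = f w"
  using assms unfolding min_value_def minimizers_def
  by (intro antisym INF_lower INF_greatest) auto

lemma ereal_convex_imp_convex_on:
  assumes "ereal_convex f" "convex \<Omega>" and F: "\<And>x. x \<in> \<Omega> \<Longrightarrow> f x = ereal (F x)"
  shows "convex_on \<Omega> F"
  unfolding convex_on_def
proof (intro conjI ballI allI impI)
  fix x y :: 'a and u v :: real
  assume xy: "x \<in> \<Omega>" "y \<in> \<Omega>" and uv: "0 \<le> u" "0 \<le> v" "u + v = 1"
  then have "u *\<^sub>R x + v *\<^sub>R y \<in> \<Omega>" using \<open>convex \<Omega>\<close> by (auto simp: convex_def)
  moreover have "f (u *\<^sub>R x + v *\<^sub>R y) \<le> ereal u * f x + ereal v * f y"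
    using \<open>ereal_convex f\<close> uv unfolding ereal_convex_def by blast
  ultimately show "F (u *\<^sub>R x + v *\<^sub>R y) \<le> u * F x + v * F y"
    using xy by (simp add: F)
qed (fact \<open>convex \<Omega>\<close>)

lemma subdifferential_real:
  assumes F: "\<And>x. x \<in> \<Omega> \<Longrightarrow> f x = ereal (F x)"
    and "x \<in> \<Omega>" "u \<in> \<Omega>" "v \<in> subdifferential f x"
  shows "F x + v \<bullet> (u - x) \<le> F u"
proof -
  have "f x + ereal (v \<bullet> (u - x)) \<le> f u" using assms(4) by (simp add: subdifferential_def)
  then show ?thesis using assms(2,3) by (simp add: F)
qed

text \<open>
  A single subgradient \<open>v\<close> at the limit \<open>w\<close> of minimizers \<open>X n\<close> suffices: it supplies the affine
  minorant \<open>F w + v \<bullet> (y - w) \<le> F y\<close>, which at \<open>y = X n\<close> tends to \<open>F w\<close>, so that \<open>F w\<close>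
  cannot exceed the minimum.
\<close>
lemma closed_minimizers:
  fixes f :: "'a::real_inner \<Rightarrow> ereal"
  assumes "closed \<Omega>" and F: "\<And>x. x \<in> \<Omega> \<Longrightarrow> f x = ereal (F x)"
    and ne: "\<And>w. w \<in> \<Omega> \<Longrightarrow> subdifferential f w \<noteq> {}"
  shows "closed (minimizers f \<Omega>)"
  unfolding closed_sequential_limits
proof (intro allI impI, elim conjE)
  fix X w assume X: "\<forall>n. X n \<in> minimizers f \<Omega>" and lim: "X \<longlonglongrightarrow> w"
  have X\<Omega>: "X n \<in> \<Omega>" for n using X by (auto simp: minimizers_def)
  then have w: "w \<in> \<Omega>" using \<open>closed \<Omega>\<close> lim closed_sequentially by blast
  then obtain v where v: "v \<in> subdifferential f w" using ne by blast
  have "F w \<le> F u" if u: "u \<in> \<Omega>" for u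
  proof -
    have "F w + v \<bullet> (X n - w) \<le> F u" for n
    proof -
      have "F (X n) \<le> F u" using X u X\<Omega> by (fastforce simp: minimizers_def F)
      with subdifferential_real[OF F w X\<Omega> v] show ?thesis by (meson order_trans)
    qed
    moreover have "(\<lambda>n. F w + v \<bullet> (X n - w)) \<longlonglongrightarrow> F w + v \<bullet> (w - w)"
      by (intro tendsto_intros lim)
    ultimately show ?thesis by (auto dest: LIMSEQ_le_const2)
  qed
  then show "w \<in> minimizers f \<Omega>" using w by (simp add: minimizers_def F)
qed

theorem corollary9:
  fixes f :: "real ^ 'd \<Rightarrow> ereal"
    and \<Omega> :: "(real ^ 'd) set"
    and w0 :: "real ^ 'd"
    and G \<kappa> \<alpha> \<epsilon>0 :: real
  assumes "\<And>x. f x \<noteq> -\<infinity>"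
    and "lower_semicontinuous f"
    and "ereal_convex f"
    and "\<Omega> \<subseteq> effective_domain f"
    and "closed \<Omega>"
    and "convex \<Omega>"
    and "minimizers f \<Omega> \<noteq> {}"
    and "G > 0"
    and "\<And>w. w \<in> \<Omega> \<Longrightarrow> subdifferential f w \<noteq> {}"
    and "\<And>w v. w \<in> \<Omega> \<Longrightarrow> v \<in> subdifferential f w \<Longrightarrow> norm v \<le> G"
    and "polyhedron (epigraph_over f \<Omega>)"
    and "\<kappa> > 0"
    and "\<And>w. w \<in> \<Omega> \<Longrightarrow>
           ereal (norm (w - closest_point (minimizers f \<Omega>) w)) \<le> (f w - min_value f \<Omega>) / ereal \<kappa>"
    and "w0 \<in> \<Omega>"
    and "\<alpha> > 1"
    and "\<epsilon>0 > 0"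
    and "f w0 - min_value f \<Omega> \<le> ereal \<epsilon>0"
  shows "\<exists>C>0. \<forall>\<epsilon>\<in>{0<..\<epsilon>0}. \<forall>g. subgradient_oracle f \<Omega> g \<longrightarrow>
           (let t = nat \<lceil>\<alpha>\<^sup>2 * G\<^sup>2 / \<kappa>\<^sup>2\<rceil>;
                K = nat \<lceil>log \<alpha> (\<epsilon>0 / \<epsilon>)\<rceil>
            in f (rsg \<Omega> G \<epsilon>0 g w0 K t \<alpha>) - min_value f \<Omega> \<le> ereal \<epsilon> \<and>
               real (rsg_iterations K t)
                 \<le> C * (\<alpha>\<^sup>2 * G\<^sup>2 / \<kappa>\<^sup>2) * real_of_int \<lceil>log \<alpha> (\<epsilon>0 / \<epsilon>)\<rceil>)"
proof -
  define F where "F x = real_of_ereal (f x)" for x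
  have F: "f x = ereal (F x)" if "x \<in> \<Omega>" for x
    using assms(1)[of x] assms(4) that
    by (auto simp: F_def effective_domain_def ereal_real)
  define p where "p = closest_point (minimizers f \<Omega>)"
  define m where "m = F (p w0)"
  have closed: "closed (minimizers f \<Omega>)"
    by (rule closed_minimizers[OF assms(5) F assms(9)])
  have p: "p x \<in> minimizers f \<Omega>" for x
    unfolding p_def using closed assms(7) by (rule closest_point_in_set)
  then have p\<Omega>: "p x \<in> \<Omega>" for x by (auto simp: minimizers_def)
  have min: "min_value f \<Omega> = ereal m"
    using min_value_eq[OF p] F[OF p\<Omega>] by (simp add: m_def)
  have Fp: "F (p x) = m" for x
    using min_value_eq[OF p[of x]] F[OF p\<Omega>[of x]] min by simp
  have error_bound: "norm (x - p x) \<le> (F x - m) / \<kappa>" if "x \<in> \<Omega>" for x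
    using assms(13)[OF that] \<open>\<kappa> > 0\<close> by (simp add: F[OF that] min p_def)
  have F_convex: "convex_on \<Omega> F"
    by (rule ereal_convex_imp_convex_on[OF assms(3,6) F])
  have w0_gap: "F w0 - m \<le> \<epsilon>0"
    using assms(17) by (simp add: F[OF assms(14)] min)
  define a where "a = \<alpha>\<^sup>2 * G\<^sup>2 / \<kappa>\<^sup>2"
  have a: "a > 0" using assms(8,12,15) by (simp add: a_def)
  show ?thesis
  proof (intro exI[of _ "1 + 1 / a"] conjI ballI allI impI)
    show "1 + 1 / a > 0" using a by (simp add: add_pos_pos)
  next
    fix \<epsilon> g
    assume "\<epsilon> \<in> {0<..\<epsilon>0}" and g: "subgradient_oracle f \<Omega> g"
    then have \<epsilon>: "0 < \<epsilon>" "\<epsilon> \<le> \<epsilon>0" by auto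
    let ?t = "nat \<lceil>a\<rceil>" and ?K = "nat \<lceil>log \<alpha> (\<epsilon>0 / \<epsilon>)\<rceil>"
    let ?w = "rsg \<Omega> G \<epsilon>0 g w0 ?K ?t \<alpha>"
    have answers: "g k n y \<in> subdifferential f y" if "y \<in> \<Omega>" for k n y
      using g that by (simp add: subgradient_oracle_def)
    have log: "0 \<le> log \<alpha> (\<epsilon>0 / \<epsilon>)"
      using \<epsilon> assms(15) by (simp add: zero_le_log_cancel_iff)
    then have K: "real ?K = real_of_int \<lceil>log \<alpha> (\<epsilon>0 / \<epsilon>)\<rceil>" by simp
    have gap: "?w \<in> \<Omega> \<and> F ?w - m \<le> \<epsilon>0 / \<alpha> ^ ?K"
    proof (rule rsg_gap[where \<kappa>=\<kappa> and p=p])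
      show "\<alpha>\<^sup>2 * G\<^sup>2 / \<kappa>\<^sup>2 \<le> real ?t" unfolding a_def by linarith
      show "F y + g k n y \<bullet> (u - y) \<le> F u" if "y \<in> \<Omega>" "u \<in> \<Omega>" for k n y u
        using subdifferential_real[OF F that answers[OF that(1)]] .
      show "norm (g k n y) \<le> G" if "y \<in> \<Omega>" for k n y
        by (rule assms(10)[OF that answers[OF that]])
    qed (use assms F_convex p\<Omega> Fp error_bound w0_gap in auto)
    have "\<epsilon>0 / \<epsilon> = \<alpha> powr log \<alpha> (\<epsilon>0 / \<epsilon>)"
      using \<epsilon> assms(15,16) by simp
    also have "\<dots> \<le> \<alpha> powr real ?K"
      using assms(15) by (intro powr_mono) (simp_all, linarith)
    also have "\<dots> = \<alpha> ^ ?K" using assms(15) by (simp add: powr_realpow)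
    finally have "\<epsilon>0 / \<alpha> ^ ?K \<le> \<epsilon>"
      using \<epsilon> assms(15) by (simp add: field_simps)
    with gap have "f ?w - min_value f \<Omega> \<le> ereal \<epsilon>"
      by (simp add: F min)
    \<comment> \<open>Rounding up costs at most one iteration per stage; since \<open>a\<close> may be small, this is
       absorbed by a constant that depends on \<open>a\<close>.\<close>
    moreover have "(1 + 1 / a) * a = a + 1"
      using a by (simp add: field_simps)
    then have "real ?t \<le> (1 + 1 / a) * a"
      using a by linarith
    then have "real (rsg_iterations ?K ?t) \<le> (1 + 1 / a) * a * real_of_int \<lceil>log \<alpha> (\<epsilon>0 / \<epsilon>)\<rceil>"
      unfolding rsg_iterations_def of_nat_mult K[symmetric] by (rule mult_right_mono) simp
    ultimately show "let t = nat \<lceil>\<alpha>\<^sup>2 * G\<^sup>2 / \<kappa>\<^sup>2\<rceil>; K = nat \<lceil>log \<alpha> (\<epsilon>0 / \<epsilon>)\<rceil>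
       in f (rsg \<Omega> G \<epsilon>0 g w0 K t \<alpha>) - min_value f \<Omega> \<le> ereal \<epsilon> \<and>
          real (rsg_iterations K t)
            \<le> (1 + 1 / a) * (\<alpha>\<^sup>2 * G\<^sup>2 / \<kappa>\<^sup>2) * real_of_int \<lceil>log \<alpha> (\<epsilon>0 / \<epsilon>)\<rceil>"
      unfolding a_def[symmetric] Let_def by blast
  qed
qed

end
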